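(* Let $n,d\ge 1$, $r\ge 0$, $m\ge 0$ be integers, let $X\in\mathbb{R}^{n\times d}$ be a fixed matrix (context) and $W_V\in\mathbb{R}^{d\times d}$ a fixed matrix, and let $S_X$, $\Pi_X$, $t_X$, $\nu_X$, $\mathcal{L}(r)$, $\mathcal{P}(m)$ be as defined in the context. Define $$D_{\mathrm{LoRA}}:=\min\{t_X,r,\nu_X\},\qquad D_{\mathrm{PT}}:=\min\{m,\nu_X\}.$$ Then: (i) $\mathcal{L}(r)\subseteq\mathcal{P}(m)$ if and only if $D_{\mathrm{LoRA}}\le D_{\mathrm{PT}}$. (ii) $\mathcal{P}(m)\subseteq\mathcal{L}(r)$ if and only if $D_{\mathrm{PT}}\le D_{\mathrm{LoRA}}$. Consequently, the strict inclusion $\mathcal{L}(r)\subsetneq\mathcal{P}(m)$ holds if and only if $D_{\mathrm{LoRA}}<D_{\mathrm{PT}}$; the strict inclusion $\mathcal{P}(m)\subsetneq\mathcal{L}(r)$ holds if and only if $D_{\mathrm{PT}}<D_{\mathrm{LoRA}}$; and equality $\mathcal{L}(r)=\mathcal{P}(m)$ holds if and only if $D_{\mathrm{LoRA}}=D_{\mathrm{PT}}$.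
   Context: Vectors in $\mathbb{R}^d$ are treated as row vectors; $x_i$ denotes the $i$-th row of $X$ and $(P_V)_p$ the $p$-th row of $P_V$. Set $v_i:=x_iW_V$ for $i=1,\dots,n$ and $S_X:=\mathrm{span}\{v_1,\dots,v_n\}\subseteq\mathbb{R}^d$. $\Pi_X$ is the orthogonal projector of $\mathbb{R}^d$ (Euclidean inner product) onto the orthogonal complement $S_X^\perp$. $t_X:=\mathrm{rank}(X)$ and $\nu_X:=\dim S_X^\perp=d-\dim S_X$. For $\Delta_V\in\mathbb{R}^{d\times d}$ put $v_i':=x_i(W_V+\Delta_V)$. The families of novelty subspaces (sets of linear subspaces of $S_X^\perp$) are $$\mathcal{L}(r):=\{\Pi_X\,\mathrm{span}\{v_1',\dots,v_n'\} : \Delta_V\in\mathbb{R}^{d\times d},\ \mathrm{rank}(\Delta_V)\le r\},$$ $$\mathcal{P}(m):=\{\Pi_X\,\mathrm{span}\{(P_V)_1,\dots,(P_V)_m\} : P_V\in\mathbb{R}^{m\times d}\}.$$ Here $\Pi_X T$ denotes the image of a subspace $T$ under $\Pi_X$. *)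

theory Defs
  imports "HOL-Analysis.Analysis"
begin

definition orth_proj :: "'a::euclidean_space set \<Rightarrow> 'a \<Rightarrow> 'a"
  where "orth_proj U x = (THE y. y \<in> U \<and> x - y \<in> orthogonal_comp U)"

lemma orth_proj_unique:
  fixes U :: "'a::euclidean_space set"
  assumes "subspace U"
  shows "\<exists>!y. y \<in> U \<and> x - y \<in> orthogonal_comp U"
proof -
  have "x \<in> U + orthogonal_comp U"
    using subspace_sum_orthogonal_comp[OF assms] by simp
  then obtain y z where yz: "y \<in> U" "z \<in> orthogonal_comp U" "x = y + z"
    by (auto elim: set_plus_elim)
  show ?thesis
  proof (intro ex1I[of _ y] conjI)
    show "y \<in> U" "x - y \<in> orthogonal_comp U" using yz by auto
    fix w assume w: "w \<in> U \<and> x - w \<in> orthogonal_comp U"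
    have "w - y \<in> U" using w yz assms by (simp add: subspace_diff)
    moreover have "(x - y) - (x - w) \<in> orthogonal_comp U"
      using w yz by (metis add_diff_cancel_left' subspace_diff subspace_orthogonal_comp)
    then have "w - y \<in> orthogonal_comp U" by simp
    ultimately show "w = y"
      by (metis (mono_tags, lifting) eq_iff_diff_eq_0 mem_Collect_eq orthogonal_comp_def orthogonal_self)
  qed
qed

lemma orth_proj_mem:
  assumes "subspace U"
  shows "orth_proj U x \<in> U" and "x - orth_proj U x \<in> orthogonal_comp U"
  using theI'[OF orth_proj_unique[OF assms, of x]] by (auto simp: orth_proj_def)

text \<open>Vectors are row vectors, so the weights act from the right: \<open>v\<^sub>i = x\<^sub>i W\<close>.\<close>

definition value_span :: "real^'d^'n \<Rightarrow> real^'d^'d \<Rightarrow> (real^'d) set"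
  where "value_span X W = span (range (\<lambda>i. row i X v* W))"

definition novelty_proj :: "real^'d^'n \<Rightarrow> real^'d^'d \<Rightarrow> real^'d \<Rightarrow> real^'d"
  where "novelty_proj X W = orth_proj (orthogonal_comp (value_span X W))"

definition novelty_dim :: "real^'d^'n \<Rightarrow> real^'d^'d \<Rightarrow> nat"
  where "novelty_dim X W = dim (orthogonal_comp (value_span X W))"

definition lora_family :: "real^'d^'n \<Rightarrow> real^'d^'d \<Rightarrow> nat \<Rightarrow> (real^'d) set set"
  where "lora_family X W r =
    {novelty_proj X W ` value_span X (W + \<Delta>) | \<Delta> :: real^'d^'d. rank \<Delta> \<le> r}"

text \<open>An \<open>m \<times> d\<close> matrix is given by its rows \<open>P 0, \<dots>, P (m - 1)\<close>, with \<open>m\<close> a natural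
  number rather than an index type, so that \<open>m = 0\<close> is included. Values of \<open>P\<close>
  from \<open>m\<close> on are irrelevant.\<close>

definition pt_family :: "real^'d^'n \<Rightarrow> real^'d^'d \<Rightarrow> nat \<Rightarrow> (real^'d) set set"
  where "pt_family X W m =
    {novelty_proj X W ` span (P ` {..<m}) | P :: nat \<Rightarrow> real^'d. True}"

definition D_LoRA :: "real^'d^'n \<Rightarrow> real^'d^'d \<Rightarrow> nat \<Rightarrow> nat"
  where "D_LoRA X W r = min (rank X) (min r (novelty_dim X W))"

definition D_PT :: "real^'d^'n \<Rightarrow> real^'d^'d \<Rightarrow> nat \<Rightarrow> nat"
  where "D_PT X W m = min m (novelty_dim X W)"

end

theory Submission
  imports Defs
begin

text \<open>Put \<open>C = S\<^sub>X\<^sup>\<bottom>\<close>. Both families consist of all subspaces of \<open>C\<close> up to a certain dimension,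
  namely \<open>D_LoRA\<close> and \<open>D_PT\<close>. As both numbers are at most \<open>dim C\<close>, and \<open>C\<close> has subspaces of every
  dimension up to its own, inclusions between the families amount to inequalities between
  these numbers. For LoRA, the projector kills every \<open>x\<^sub>i W\<close>, so the novelty subspace is the image
  of the row space of \<open>X\<close> under \<open>v \<mapsto> \<Pi>\<^sub>X (v \<Delta>)\<close>; conversely a subspace of \<open>C\<close> of dimension at most
  \<open>rank X\<close> is the image of the row space under some linear map whose range is that subspace.\<close>

lemma orth_proj_eqI:
  assumes "subspace U" "y \<in> U" "x - y \<in> orthogonal_comp U"
  shows "orth_proj U x = y"
  using orth_proj_unique[OF assms(1), of x] orth_proj_mem[OF assms(1), of x] assms(2,3) by blast

text \<open>Sums and scalar multiples of orthogonal decompositions are again such decompositions,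
  and these are unique.\<close>

lemma linear_orth_proj:
  assumes "subspace U"
  shows "linear (orth_proj U)"
proof (rule linearI)
  fix x y :: 'a and c :: real
  note mem = orth_proj_mem[OF assms] and comp = subspace_orthogonal_comp[of U]
  show "orth_proj U (x + y) = orth_proj U x + orth_proj U y"
  proof (rule orth_proj_eqI[OF assms])
    show "orth_proj U x + orth_proj U y \<in> U"
      by (intro subspace_add assms mem)
    show "x + y - (orth_proj U x + orth_proj U y) \<in> orthogonal_comp U"
      using subspace_add[OF comp mem(2)[of x] mem(2)[of y]] by (simp add: algebra_simps)
  qed
  show "orth_proj U (c *\<^sub>R x) = c *\<^sub>R orth_proj U x"
  proof (rule orth_proj_eqI[OF assms])
    show "c *\<^sub>R orth_proj U x \<in> U"
      by (intro subspace_scale assms mem)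
    show "c *\<^sub>R x - c *\<^sub>R orth_proj U x \<in> orthogonal_comp U"
      using subspace_scale[OF comp mem(2)[of x], of c] by (simp add: algebra_simps)
  qed
qed

lemma orth_proj_id: "subspace U \<Longrightarrow> x \<in> U \<Longrightarrow> orth_proj U x = x"
  by (rule orth_proj_eqI) (simp_all add: subspace_0 subspace_orthogonal_comp)

lemma orth_proj_zero: "subspace U \<Longrightarrow> x \<in> orthogonal_comp U \<Longrightarrow> orth_proj U x = 0"
  by (rule orth_proj_eqI) (simp_all add: subspace_0)

lemma linear_vector_matrix_mult: "linear (\<lambda>v. v v* (A :: real^'m^'n))"
  using matrix_vector_mul_linear[of "transpose A"] by simp

lemma dim_range_vector_matrix_mult: "dim (range (\<lambda>v. v v* (A :: real^'m^'n))) = rank A"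
  using rank_dim_range[of "transpose A"] by (simp add: rank_transpose)

lemma value_span_eq_image: "value_span X A = (\<lambda>v. v v* A) ` span (rows X)"
proof -
  have "range (\<lambda>i. row i X v* A) = (\<lambda>v. v v* A) ` rows X"
    by (auto simp: rows_def)
  then show ?thesis
    by (simp add: value_span_def linear_span_image[OF linear_vector_matrix_mult])
qed

lemma linear_novelty_proj: "linear (novelty_proj X W)"
  unfolding novelty_proj_def by (intro linear_orth_proj subspace_orthogonal_comp)

lemma novelty_proj_in: "novelty_proj X W v \<in> orthogonal_comp (value_span X W)"
  unfolding novelty_proj_def by (intro orth_proj_mem subspace_orthogonal_comp)

lemma novelty_proj_id:
  "v \<in> orthogonal_comp (value_span X W) \<Longrightarrow> novelty_proj X W v = v"
  unfolding novelty_proj_def by (intro orth_proj_id subspace_orthogonal_comp)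

lemma novelty_proj_zero: "v \<in> value_span X W \<Longrightarrow> novelty_proj X W v = 0"
  \<comment> \<open>The kernel is the double orthogonal complement of the value span, which contains
    the value span itself.\<close>
  unfolding novelty_proj_def
  by (intro orth_proj_zero subspace_orthogonal_comp subsetD[OF orthogonal_comp_subset])

lemma novelty_proj_image_bounds:
  "novelty_proj X W ` T \<subseteq> orthogonal_comp (value_span X W)"
  "dim (novelty_proj X W ` T) \<le> novelty_dim X W"
proof -
  show "novelty_proj X W ` T \<subseteq> orthogonal_comp (value_span X W)"
    using novelty_proj_in by blast
  then show "dim (novelty_proj X W ` T) \<le> novelty_dim X W"
    unfolding novelty_dim_def by (rule dim_subset)
qed

lemma novelty_image_value_span:
  "novelty_proj X W ` value_span X (W + \<Delta>) = (\<lambda>v. novelty_proj X W (v v* \<Delta>)) ` span (rows X)"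
proof -
  have "novelty_proj X W (v v* (W + \<Delta>)) = novelty_proj X W (v v* \<Delta>)"
    if "v \<in> span (rows X)" for v
    using that novelty_proj_zero[of "v v* W" X W]
    by (simp add: value_span_eq_image vector_matrix_mult_add_rdistrib
        linear_add[OF linear_novelty_proj])
  then show ?thesis
    by (simp add: value_span_eq_image image_image)
qed

text \<open>Send part of a basis of \<open>R\<close> bijectively to a basis of \<open>U\<close> and
  the rest to 0. Controlling \<open>range f\<close>, and not only the image of \<open>R\<close>, is
  what later bounds the rank of \<Delta>.\<close>

lemma linear_map_onto_subspace:
  fixes R :: "'a::euclidean_space set" and U :: "'b::euclidean_space set"
  assumes "subspace R" "subspace U" "dim U \<le> dim R"
  obtains f where "linear f" "f ` R = U" "range f = U"
proof -
  obtain A where A: "finite A" "independent A" "span A = R" "card A = dim R"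
    using basis_subspace_exists[OF assms(1)] by metis
  obtain B where B: "finite B" "span B = U" "card B = dim U"
    using basis_subspace_exists[OF assms(2)] by metis
  obtain e where e: "e ` B \<subseteq> A" "inj_on e B"
    using card_le_inj[OF B(1) A(1)] A(4) B(3) assms(3) by auto
  \<comment> \<open>\<open>h\<close> undoes the injection \<open>e\<close> of the basis of
    \<open>U\<close> into that of \<open>R\<close>; the default 0 adds nothing to the span.\<close>
  define h where "h a = (if a \<in> e ` B then inv_into B e a else 0)" for a
  have sub: "h ` A \<subseteq> insert 0 B"
    by (auto simp: h_def inv_into_into)
  have "b \<in> h ` A" if "b \<in> B" for b
  proof -
    have "h (e b) = b" using that e(2) by (simp add: h_def)
    then show ?thesis using that e(1) by (metis image_eqI image_subset_iff)
  qed
  then have "B \<subseteq> h ` A" by blast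
  then have span_h: "span (h ` A) = U"
    using span_mono[OF sub] span_mono[of B "h ` A"] B(2) by simp
  \<comment> \<open>This extension from \<open>A\<close> to the whole space creates no values
    outside the span of \<open>h\<close> on \<open>A\<close>.\<close>
  obtain f where f: "linear f" "\<forall>a\<in>A. f a = h a" "range f = span (h ` A)"
    using linear_independent_extend_subspace[OF A(2), of h] by blast
  have "f ` R = span (f ` A)"
    using linear_span_image[OF f(1)] A(3) by metis
  also have "f ` A = h ` A" using f(2) by simp
  finally show thesis using that f(1,3) span_h by simp
qed

text \<open>The three terms of the minimum bound the dimension of the row space of \<open>X\<close>,
  the range of \<Delta>, and the target of the projector.\<close>

lemma lora_family_eq:
  "lora_family X W r =
    {U. subspace U \<and> U \<subseteq> orthogonal_comp (value_span X W) \<and> dim U \<le> D_LoRA X W r}"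
  (is "_ = ?F")
proof (intro equalityI subsetI)
  fix U assume "U \<in> lora_family X W r"
  then obtain \<Delta> where \<Delta>: "rank \<Delta> \<le> r" and U: "U = novelty_proj X W ` value_span X (W + \<Delta>)"
    by (auto simp: lora_family_def)
  have "linear (\<lambda>v. novelty_proj X W (v v* \<Delta>))"
    using linear_compose[OF linear_vector_matrix_mult linear_novelty_proj]
    by (simp add: o_def)
  then have "dim U \<le> dim (span (rows X))"
    unfolding U novelty_image_value_span by (rule dim_image_le)
  then have "dim U \<le> rank X"
    by (simp add: row_rank_def)
  moreover have "dim U \<le> r"
  proof -
    \<comment> \<open>Enlarging the row space to the whole space brings in the range of \<Delta>,
      whose dimension is its rank.\<close>
    have "U \<subseteq> novelty_proj X W ` range (\<lambda>v. v v* \<Delta>)"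
      unfolding U novelty_image_value_span by blast
    then have "dim U \<le> dim (novelty_proj X W ` range (\<lambda>v. v v* \<Delta>))"
      by (rule dim_subset)
    also have "\<dots> \<le> dim (range (\<lambda>v. v v* \<Delta>))"
      by (rule dim_image_le[OF linear_novelty_proj])
    finally show ?thesis using \<Delta> by (simp add: dim_range_vector_matrix_mult)
  qed
  moreover have "subspace U"
    unfolding U value_span_def by (intro linear_subspace_image linear_novelty_proj subspace_span)
  ultimately show "U \<in> ?F"
    using novelty_proj_image_bounds[of X W] U by (simp add: D_LoRA_def)
next
  fix U assume "U \<in> ?F"
  then have U: "subspace U" "U \<subseteq> orthogonal_comp (value_span X W)" "dim U \<le> rank X" "dim U \<le> r"
    by (auto simp: D_LoRA_def)
  have "dim U \<le> dim (span (rows X))"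
    using U(3) by (simp add: row_rank_def)
  then obtain f where f: "linear f" "f ` span (rows X) = U" "range f = U"
    using linear_map_onto_subspace[OF subspace_span U(1)] by blast
  \<comment> \<open>\<open>matrix f\<close> acts on column vectors; the transpose makes it act on
    rows from the right.\<close>
  define \<Delta> where "\<Delta> = transpose (matrix f)"
  have \<Delta>: "v v* \<Delta> = f v" for v
    using f(1) by (simp add: \<Delta>_def matrix_works flip: linear_def)
  have "rank \<Delta> \<le> r"
    using dim_range_vector_matrix_mult[of \<Delta>] f(3) U(4) by (simp add: \<Delta>)
  moreover have "novelty_proj X W ` value_span X (W + \<Delta>) = novelty_proj X W ` U"
    unfolding novelty_image_value_span \<Delta> by (simp add: image_image flip: f(2))
  moreover have "novelty_proj X W ` U = U"
    using U(2) novelty_proj_id by (force simp: image_iff)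
  ultimately show "U \<in> lora_family X W r"
    by (auto simp: lora_family_def)
qed

text \<open>A span of \<open>m\<close> vectors has dimension at most \<open>m\<close>, and linear
  maps do not raise dimension. Conversely, the rows can be a basis of \<open>U\<close>, which the
  projector fixes.\<close>

lemma pt_family_eq:
  "pt_family X W m =
    {U. subspace U \<and> U \<subseteq> orthogonal_comp (value_span X W) \<and> dim U \<le> D_PT X W m}"
  (is "_ = ?F")
proof (intro equalityI subsetI)
  fix U assume "U \<in> pt_family X W m"
  then obtain P where U: "U = novelty_proj X W ` span (P ` {..<m})"
    by (auto simp: pt_family_def)
  have "dim U \<le> dim (span (P ` {..<m}))"
    unfolding U by (rule dim_image_le[OF linear_novelty_proj])
  also have "\<dots> \<le> card (P ` {..<m})"
    by (simp add: dim_le_card')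
  also have "\<dots> \<le> m"
    using card_image_le[of "{..<m}" P] by simp
  finally have "dim U \<le> m" .
  moreover have "subspace U"
    unfolding U by (intro linear_subspace_image linear_novelty_proj subspace_span)
  ultimately show "U \<in> ?F"
    using novelty_proj_image_bounds[of X W] U by (simp add: D_PT_def)
next
  fix U assume "U \<in> ?F"
  then have U: "subspace U" "U \<subseteq> orthogonal_comp (value_span X W)" "dim U \<le> m"
    by (auto simp: D_PT_def)
  obtain B where B: "finite B" "span B = U" "card B = dim U"
    using basis_subspace_exists[OF U(1)] by metis
  obtain b where b: "bij_betw b {0..<card B} B"
    using ex_bij_betw_nat_finite[OF B(1)] by blast
  \<comment> \<open>Zero rows pad the basis up to length \<open>m\<close> without changing the
    span.\<close>
  define P where "P i = (if i < card B then b i else 0)" for i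
  have "B \<subseteq> P ` {..<m}"
  proof
    fix x assume "x \<in> B"
    then obtain i where "i < card B" "x = b i"
      using bij_betw_imp_surj_on[OF b] by (metis atLeastLessThan_iff imageE)
    then show "x \<in> P ` {..<m}"
      using B(3) U(3) by (intro image_eqI[of _ _ i]) (auto simp: P_def)
  qed
  moreover have "P ` {..<m} \<subseteq> insert 0 B"
    using b by (auto simp: P_def bij_betw_def)
  ultimately have "span (P ` {..<m}) = U"
    using span_mono[of B "P ` {..<m}"] span_mono[of "P ` {..<m}" "insert 0 B"] B(2) by simp
  moreover have "novelty_proj X W ` U = U"
    using U(2) novelty_proj_id by (force simp: image_iff)
  ultimately show "U \<in> pt_family X W m"
    unfolding pt_family_def by force
qed

lemma subspaces_dim_le_subset_iff:
  fixes C :: "'a::euclidean_space set"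
  assumes "subspace C" "a \<le> dim C"
  shows "{U. subspace U \<and> U \<subseteq> C \<and> dim U \<le> a} \<subseteq> {U. subspace U \<and> U \<subseteq> C \<and> dim U \<le> b}
    \<longleftrightarrow> a \<le> b"
proof -
  \<comment> \<open>A subspace of dimension exactly \<open>a\<close> tests the inclusion: its
    membership on the right forces \<open>a \<le> b\<close>.\<close>
  obtain T where "subspace T" "T \<subseteq> span C" "dim T = a"
    using choose_subspace_of_subspace[OF assms(2)] .
  moreover have "span C = C" using assms(1) by (simp add: span_eq_iff)
  ultimately show ?thesis by auto
qed

theorem theorem1:
  fixes X :: "real^'d^'n" and W :: "real^'d^'d" and r m :: nat
  shows "(lora_family X W r \<subseteq> pt_family X W m \<longleftrightarrow> D_LoRA X W r \<le> D_PT X W m)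
    \<and> (pt_family X W m \<subseteq> lora_family X W r \<longleftrightarrow> D_PT X W m \<le> D_LoRA X W r)
    \<and> (lora_family X W r \<subset> pt_family X W m \<longleftrightarrow> D_LoRA X W r < D_PT X W m)
    \<and> (pt_family X W m \<subset> lora_family X W r \<longleftrightarrow> D_PT X W m < D_LoRA X W r)
    \<and> (lora_family X W r = pt_family X W m \<longleftrightarrow> D_LoRA X W r = D_PT X W m)"
proof -
  have "D_LoRA X W r \<le> dim (orthogonal_comp (value_span X W))"
    "D_PT X W m \<le> dim (orthogonal_comp (value_span X W))"
    by (simp_all add: D_LoRA_def D_PT_def novelty_dim_def)
  then have "lora_family X W r \<subseteq> pt_family X W m \<longleftrightarrow> D_LoRA X W r \<le> D_PT X W m"
    and "pt_family X W m \<subseteq> lora_family X W r \<longleftrightarrow> D_PT X W m \<le> D_LoRA X W r"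
    unfolding lora_family_eq pt_family_eq
    by (simp_all only: subspaces_dim_le_subset_iff[OF subspace_orthogonal_comp])
  \<comment> \<open>Strict inclusion and equality are combinations of the two inclusions, as
    \<open><\<close> and \<open>=\<close> are of the two inequalities.\<close>
  then show ?thesis
    by (auto simp only: less_le_not_le set_eq_subset order_eq_iff[of "D_LoRA X W r"])
qed

end
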